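(* Define functions $p(k,t)$, for integers $k\ge 0$ and real $t\ge 0$, by $$p(0,t)=e^{-t},\qquad p(k,t)=\frac{1}{k!}\sum_{j=1}^{k+1}(-1)^{k+1-j}\,j^k\binom{k+1}{j}e^{-t/j}\quad\text{for } k\ge 1 .$$ Then $(p(k,\cdot))_{k\ge 0}$ is the solution of the system of differential equations $$\begin{cases} p'(0,t)=-p(0,t),\\[2pt] p'(k,t)=\dfrac1k\,p(k-1,t)-\dfrac{1}{1+k}\,p(k,t), & k\ge 1,\end{cases}$$ for $t\ge 0$, with initial conditions $p(0,0)=1$ and $p(k,0)=0$ for all $k\ge 1$, where $'$ denotes the derivative with respect to $t$.
   Context: The system is the system of forward (Kolmogorov) equations for $p(k,t)=P(X(t)=k)$, where $\{X(t):t\ge 0\}$ is the pure birth process on $\{0,1,2,\dots\}$ started at $X(0)=0$ which jumps from $k$ to $k+1$ at rate $\lambda_k=\frac{1}{1+k}$. *)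

theory Defs
  imports Complex_Main
begin

definition p :: "nat \<Rightarrow> real \<Rightarrow> real" where
  "p k t = (if k = 0 then exp (- t)
     else 1 / fact k *
       (\<Sum>j = 1..k + 1. (-1) ^ (k + 1 - j) * real j ^ k * real ((k + 1) choose j) * exp (- t / real j)))"

text \<open>
  The forward equations on \<open>[0, \<infinity>)\<close>, with initial conditions, of the pure birth process on
  the natural numbers started at 0 that jumps from \<open>k\<close> to \<open>k + 1\<close> at rate \<open>1 / (1 + k)\<close>.
  The derivative is taken within \<open>[0, \<infinity>)\<close>: it is the ordinary derivative for \<open>t > 0\<close> and the
  right derivative at \<open>t = 0\<close>, so nothing is demanded of \<open>q\<close> at negative times.
\<close>

definition solves_forward_system :: "(nat \<Rightarrow> real \<Rightarrow> real) \<Rightarrow> bool" where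
  "solves_forward_system q \<longleftrightarrow>
     (\<forall>t\<ge>0. (q 0 has_real_derivative - q 0 t) (at t within {0..})) \<and>
     (\<forall>k\<ge>1. \<forall>t\<ge>0. (q k has_real_derivative
         1 / real k * q (k - 1) t - 1 / (1 + real k) * q k t) (at t within {0..})) \<and>
     q 0 0 = 1 \<and> (\<forall>k\<ge>1. q k 0 = 0)"

end

theory Submission
  imports Defs "HOL-Analysis.Derivative"
begin

text \<open>
  Up to normalisation, the coefficient of \<open>exp (- t / j)\<close> in \<open>p k\<close> is the \<open>j\<close>-th term of the
  alternating binomial sum that computes the \<open>(k + 1)\<close>-st finite difference of \<open>x ^ k\<close> at \<open>0\<close>.
  Two facts follow. At \<open>t = 0\<close> all the exponentials equal 1, so for \<open>k \<ge> 1\<close> the value \<open>p k 0\<close> is a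
  multiple of that finite difference, which vanishes because the degree \<open>k\<close> is below the order \<open>k + 1\<close>
  (\<open>alternating_binomial_sum_power_eq_0\<close>). And since each \<open>exp (- t / j)\<close> is an eigenfunction of
  differentiation, the differential equations amount to a recurrence between the coefficients of
  \<open>p (k + 1)\<close> and those of \<open>p k\<close>, which is the absorption identity for binomial coefficients
  (\<open>p_coeff_Suc\<close>).

  For uniqueness, the system is triangular: once \<open>q (k - 1)\<close> and \<open>p (k - 1)\<close> agree, the difference
  \<open>q k - p k\<close> solves the homogeneous linear equation \<open>d' = - d / (1 + k)\<close> with \<open>d 0 = 0\<close>, whose
  only solution is zero (\<open>linear_ode_zero\<close>).
\<close>

text \<open>
  The \<open>n\<close>-th finite difference annihilates polynomials of degree below \<open>n\<close>. The shift \<open>x\<close> is what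
  makes the induction on the degree work: writing \<open>(x + j) ^ Suc m\<close> as
  \<open>x * (x + j) ^ m + j * (x + j) ^ m\<close> and absorbing \<open>j\<close> into the binomial coefficient yields sums of
  the same form with the shifts \<open>x\<close> and \<open>x + 1\<close>.
\<close>

lemma alternating_binomial_sum_power_eq_0:
  fixes x :: "'a::comm_ring_1"
  assumes "m < n"
  shows "(\<Sum>j\<le>n. (-1) ^ j * of_nat (n choose j) * (x + of_nat j) ^ m) = 0"
  using assms
proof (induction m arbitrary: n x)
  case 0
  then show ?case
    using choose_alternating_sum[of n] by simp
next
  case (Suc m)
  then obtain n' where n: "n = Suc n'" and "m < n'"
    by (cases n) auto
  have "(\<Sum>j\<le>n. (-1) ^ j * of_nat (n choose j) * (of_nat j * (x + of_nat j) ^ m))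
      = (\<Sum>i\<le>n'. (-1) ^ Suc i * of_nat (n choose Suc i) * (of_nat (Suc i) * (x + of_nat (Suc i)) ^ m))"
    unfolding n by (subst sum.atMost_Suc_shift) simp
  also have "\<dots> = (\<Sum>i\<le>n'. - of_nat n *
      ((-1) ^ i * of_nat (n' choose i) * ((x + 1) + of_nat i) ^ m))"
  proof (intro sum.cong refl)
    fix i
    have "of_nat (n choose Suc i) * of_nat (Suc i) = (of_nat n * of_nat (n' choose i) :: 'a)"
      unfolding n of_nat_mult[symmetric] using Suc_times_binomial[of i n'] by (simp only: mult.commute)
    moreover have "x + of_nat (Suc i) = (x + 1) + of_nat i"
      by (simp add: add_ac)
    moreover have "(-1) ^ Suc i * b * (c * y) = - a * ((-1) ^ i * d * y)" if "b * c = a * d"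
      for a b c d y :: 'a
    proof -
      have "(-1) ^ Suc i * b * (c * y) = - ((-1) ^ i * (b * c) * y)"
        by (simp add: mult_ac)
      also have "\<dots> = - a * ((-1) ^ i * d * y)"
        unfolding that by (simp add: mult_ac)
      finally show ?thesis .
    qed
    ultimately show "(-1) ^ Suc i * of_nat (n choose Suc i) * (of_nat (Suc i) * (x + of_nat (Suc i)) ^ m)
        = - of_nat n * ((-1) ^ i * of_nat (n' choose i) * ((x + 1) + of_nat i) ^ m)"
      by metis
  qed
  also have "\<dots> = 0"
    using Suc.IH[OF \<open>m < n'\<close>, of "x + 1"] by (simp only: sum_distrib_left[symmetric] mult_zero_right)
  finally have absorbed:
    "(\<Sum>j\<le>n. (-1) ^ j * of_nat (n choose j) * (of_nat j * (x + of_nat j) ^ m)) = 0" .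
  have "(\<Sum>j\<le>n. (-1) ^ j * of_nat (n choose j) * (x + of_nat j) ^ Suc m)
      = x * (\<Sum>j\<le>n. (-1) ^ j * of_nat (n choose j) * (x + of_nat j) ^ m)
        + (\<Sum>j\<le>n. (-1) ^ j * of_nat (n choose j) * (of_nat j * (x + of_nat j) ^ m))"
    by (simp add: sum_distrib_left sum.distrib[symmetric] algebra_simps)
  also have "\<dots> = 0"
    using Suc.IH[of n x] Suc.prems absorbed by simp
  finally show ?case .
qed

text \<open>
  The formula also covers \<open>k = 0\<close>: there the range of summation is \<open>j = 1\<close> alone and the coefficient
  is 1, which gives \<open>exp (- t)\<close>.
\<close>

definition p_coeff :: "nat \<Rightarrow> nat \<Rightarrow> real" where
  "p_coeff k j = (-1) ^ (k + 1 - j) * real j ^ k * real ((k + 1) choose j) / fact k"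

lemma p_eq_sum: "p k t = (\<Sum>j = 1..k + 1. p_coeff k j * exp (- t / real j))"
  by (cases "k = 0") (simp_all add: p_def p_coeff_def sum_divide_distrib
      del: sum.cl_ivl_Suc binomial_Suc_Suc)

text \<open>
  This is the differential equation read off at the exponential \<open>exp (- t / j)\<close>. It holds because
  \<open>1 / (k + 2) - 1 / j\<close> has the numerator \<open>- (k + 2 - j)\<close>, the factor by which the absorption identity
  \<open>(k + 2 - j) * (k + 2 choose j) = (k + 2) * (k + 1 choose j)\<close> lowers the binomial
  coefficient of \<open>p (k + 1)\<close> to that of \<open>p k\<close>.
\<close>

lemma p_coeff_Suc:
  assumes "1 \<le> j" "j \<le> k + 1"
  shows "p_coeff (Suc k) j * (- 1 / real j)
    = 1 / real (Suc k) * p_coeff k j - 1 / (1 + real (Suc k)) * p_coeff (Suc k) j"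
proof -
  obtain i where i: "k + 1 = j + i"
    using assms le_Suc_ex by blast
  have "(Suc (k + 1) - j) * (Suc (k + 1) choose j) = Suc (k + 1) * (k + 1 choose j)"
    using binomial_absorb_comp[of "Suc (k + 1)" j] by simp
  then have "real (Suc (k + 1) - j) * real (Suc (k + 1) choose j)
      = real (Suc (k + 1)) * real (k + 1 choose j)"
    by (simp only: flip: of_nat_mult)
  then have absorb:
    "(real k + 2 - real j) * real (Suc (k + 1) choose j) = (real k + 2) * real (k + 1 choose j)"
    using assms by (simp add: of_nat_diff add_ac del: binomial_Suc_Suc)
  have "Suc (Suc k) - j = Suc i" "Suc k - j = i"
    using i by simp_all
  \<comment> \<open>The identity in the variables \<open>J = j\<close>, \<open>K = k\<close>, \<open>B = (k + 2 choose j)\<close>: split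
    \<open>K + 2\<close> as \<open>(K + 2 - J) + J\<close>.\<close>
  have partial_fractions: "- s * J * B / (K + 1) * (- 1 / J)
      = 1 / (K + 1) * (s * ((K + 2 - J) * B / (K + 2))) - 1 / (K + 2) * (- s * J * B / (K + 1))"
    if "J > 0" "K \<ge> 0" for s B J K :: real
  proof -
    have "- s * J * B / (K + 1) * (- 1 / J) = s * B / (K + 1)"
      using that by simp
    also have "\<dots> = s * B * ((K + 2 - J) + J) / ((K + 1) * (K + 2))"
      using that by simp
    also have "\<dots> = 1 / (K + 1) * (s * ((K + 2 - J) * B / (K + 2)))
        - 1 / (K + 2) * (- s * J * B / (K + 1))"
      unfolding distrib_left[of "s * B"] add_divide_distrib by (simp add: mult_ac)
    finally show ?thesis .
  qed
  define s where "s = (-1::real) ^ i * real j ^ k / fact k"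
  have "p_coeff (Suc k) j = - s * real j * real (Suc (k + 1) choose j) / real (Suc k)"
    using \<open>Suc (Suc k) - j = Suc i\<close> by (simp add: p_coeff_def s_def mult_ac del: binomial_Suc_Suc)
  moreover have "p_coeff k j = s * real (k + 1 choose j)"
    using \<open>Suc k - j = i\<close> by (simp add: p_coeff_def s_def)
  moreover have "real (k + 1 choose j)
      = (real k + 2 - real j) * real (Suc (k + 1) choose j) / (real k + 2)"
    using absorb by (simp add: field_simps)
  moreover have "- s * real j * real (Suc (k + 1) choose j) / real (Suc k) * (- 1 / real j)
      = 1 / real (Suc k) * (s * ((real k + 2 - real j) * real (Suc (k + 1) choose j) / (real k + 2)))
        - 1 / (1 + real (Suc k)) * (- s * real j * real (Suc (k + 1) choose j) / real (Suc k))"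
    using partial_fractions[of "real j" "real k" s "real (Suc (k + 1) choose j)"] assms
    by (simp add: add_ac del: binomial_Suc_Suc)
  ultimately show ?thesis
    by (simp only:)
qed

lemma p_0_eq: "p 0 t = exp (- t)"
  by (simp add: p_def)

lemma has_derivative_p:
  "(p k has_real_derivative (\<Sum>j = 1..k + 1. p_coeff k j * (- 1 / real j) * exp (- t / real j)))
     (at t within A)"
  unfolding p_eq_sum[abs_def]
  by (rule DERIV_sum) (auto intro!: derivative_eq_intros)

text \<open>
  The sum for \<open>p (Suc k)\<close> has one exponential that does not occur in \<open>p k\<close>, namely the one with
  \<open>j = k + 2\<close>. It decays at exactly the rate \<open>1 / (1 + Suc k)\<close> of the homogeneous equation, so it
  needs no contribution from \<open>p k\<close>; the other exponentials are matched by \<open>p_coeff_Suc\<close>.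
\<close>

lemma p_forward_equation:
  "(p (Suc k) has_real_derivative
      1 / real (Suc k) * p k t - 1 / (1 + real (Suc k)) * p (Suc k) t) (at t within A)"
proof -
  have "(\<Sum>j = 1..Suc k + 1. p_coeff (Suc k) j * (- 1 / real j) * exp (- t / real j))
      = (\<Sum>j = 1..k + 1. p_coeff (Suc k) j * (- 1 / real j) * exp (- t / real j))
        - 1 / (1 + real (Suc k)) * (p_coeff (Suc k) (k + 2) * exp (- t / real (k + 2)))"
    by simp
  also have "(\<Sum>j = 1..k + 1. p_coeff (Suc k) j * (- 1 / real j) * exp (- t / real j))
      = (\<Sum>j = 1..k + 1. 1 / real (Suc k) * (p_coeff k j * exp (- t / real j))
          - 1 / (1 + real (Suc k)) * (p_coeff (Suc k) j * exp (- t / real j)))"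
  proof (intro sum.cong refl)
    fix j assume "j \<in> {1..k + 1}"
    then have "1 \<le> j" "j \<le> k + 1"
      by simp_all
    then show "p_coeff (Suc k) j * (- 1 / real j) * exp (- t / real j)
        = 1 / real (Suc k) * (p_coeff k j * exp (- t / real j))
          - 1 / (1 + real (Suc k)) * (p_coeff (Suc k) j * exp (- t / real j))"
      by (simp only: p_coeff_Suc left_diff_distrib mult.assoc)
  qed
  also have "\<dots> = 1 / real (Suc k) * p k t
      - 1 / (1 + real (Suc k)) * (\<Sum>j = 1..k + 1. p_coeff (Suc k) j * exp (- t / real j))"
    by (simp only: p_eq_sum sum_subtractf sum_distrib_left)
  also have "\<dots> - 1 / (1 + real (Suc k)) * (p_coeff (Suc k) (k + 2) * exp (- t / real (k + 2)))
      = 1 / real (Suc k) * p k t - 1 / (1 + real (Suc k)) * p (Suc k) t"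
  proof -
    have "p (Suc k) t = (\<Sum>j = 1..k + 1. p_coeff (Suc k) j * exp (- t / real j))
        + p_coeff (Suc k) (k + 2) * exp (- t / real (k + 2))"
      by (simp add: p_eq_sum)
    then show ?thesis
      by (simp only: distrib_left diff_diff_eq)
  qed
  finally show ?thesis
    using has_derivative_p[of "Suc k" t A] by simp
qed

lemma p_initial:
  assumes "k \<ge> 1"
  shows "p k 0 = 0"
proof -
  have sign: "(-1::real) ^ (k + 1 - j) = (-1) ^ (k + 1) * (-1) ^ j" if "j \<le> k + 1" for j
    using that by (simp add: minus_one_power_iff)
  \<comment> \<open>Since \<open>k\<close> is positive, the finite difference has no term at \<open>j = 0\<close>.\<close>
  have "p k 0 = (\<Sum>j\<le>k + 1. p_coeff k j)"
    unfolding p_eq_sum using assms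
    by (intro sum.mono_neutral_cong_left) (auto simp: p_coeff_def not_le)
  also have "\<dots> = (-1) ^ (k + 1) / fact k *
      (\<Sum>j\<le>k + 1. (-1) ^ j * real (k + 1 choose j) * (0 + real j) ^ k)"
    unfolding sum_distrib_left
    by (intro sum.cong refl) (simp only: p_coeff_def sign atMost_iff, simp add: mult_ac)
  also have "\<dots> = 0"
    by (simp only: alternating_binomial_sum_power_eq_0[of k "k + 1"] less_add_one mult_zero_right)
  finally show ?thesis .
qed

lemma p_solves: "solves_forward_system p"
  unfolding solves_forward_system_def
proof (intro conjI allI impI)
  fix t :: real
  show "(p 0 has_real_derivative - p 0 t) (at t within {0..})"
    unfolding p_0_eq[abs_def] by (auto intro!: derivative_eq_intros)
next
  fix k t assume "1 \<le> (k::nat)"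
  then show "(p k has_real_derivative
      1 / real k * p (k - 1) t - 1 / (1 + real k) * p k t) (at t within {0..})"
    using p_forward_equation[of "k - 1"] by simp
qed (simp_all add: p_0_eq p_initial)

text \<open>The integrating factor \<open>exp (a * t)\<close> turns a solution into a constant.\<close>

lemma linear_ode_zero:
  fixes d :: "real \<Rightarrow> real"
  assumes deriv: "\<And>t. t \<ge> 0 \<Longrightarrow> (d has_real_derivative - a * d t) (at t within {0..})"
    and "d 0 = 0" and "t \<ge> 0"
  shows "d t = 0"
proof -
  have "((\<lambda>t. exp (a * t) * d t) has_real_derivative 0) (at t within {0..})" if "t \<in> {0..}" for t
    using that by (auto intro!: derivative_eq_intros deriv simp: algebra_simps)
  then obtain c where "exp (a * t) * d t = c" if "t \<in> {0..}" for t
    using has_field_derivative_zero_constant[of "{0..}" "\<lambda>t. exp (a * t) * d t"] by auto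
  from this[of 0] this[of t] show ?thesis
    using assms(2,3) by simp
qed

text \<open>
  In the induction step the common value of \<open>q k\<close> and \<open>r k\<close> cancels from the difference of the two
  equations at level \<open>Suc k\<close>, which leaves the homogeneous equation.
\<close>

lemma forward_system_unique:
  assumes q: "solves_forward_system q" and r: "solves_forward_system r" and "t \<ge> 0"
  shows "q k t = r k t"
  using \<open>t \<ge> 0\<close>
proof (induction k arbitrary: t)
  case 0
  have "q 0 t - r 0 t = 0"
  proof (rule linear_ode_zero[where a = 1 and d = "\<lambda>t. q 0 t - r 0 t"])
    show "((\<lambda>t. q 0 t - r 0 t) has_real_derivative - 1 * (q 0 t - r 0 t)) (at t within {0..})"
      if "t \<ge> 0" for t
    proof -
      have "(q 0 has_real_derivative - q 0 t) (at t within {0..})"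
        "(r 0 has_real_derivative - r 0 t) (at t within {0..})"
        using q r that by (simp_all add: solves_forward_system_def)
      from DERIV_diff[OF this] show ?thesis by simp
    qed
  qed (use q r 0 in \<open>simp_all add: solves_forward_system_def\<close>)
  then show ?case by simp
next
  case (Suc k)
  have eqn: "(f (Suc k) has_real_derivative
      1 / real (Suc k) * f k t - 1 / (1 + real (Suc k)) * f (Suc k) t) (at t within {0..})"
    if "solves_forward_system f" "t \<ge> 0" for f t
    using that unfolding solves_forward_system_def
    by (metis One_nat_def Suc_le_mono diff_Suc_1 zero_le)
  have "q (Suc k) t - r (Suc k) t = 0"
  proof (rule linear_ode_zero[where a = "1 / (1 + real (Suc k))"
        and d = "\<lambda>t. q (Suc k) t - r (Suc k) t"])
    show "((\<lambda>t. q (Suc k) t - r (Suc k) t) has_real_derivative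
        - (1 / (1 + real (Suc k))) * (q (Suc k) t - r (Suc k) t)) (at t within {0..})"
      if "t \<ge> 0" for t
    proof -
      have "- (1 / (1 + real (Suc k))) * (q (Suc k) t - r (Suc k) t)
          = 1 / real (Suc k) * q k t - 1 / (1 + real (Suc k)) * q (Suc k) t
            - (1 / real (Suc k) * r k t - 1 / (1 + real (Suc k)) * r (Suc k) t)"
        unfolding Suc.IH[OF that] by (simp only: algebra_simps)
      then show ?thesis
        using DERIV_diff[OF eqn[OF q that] eqn[OF r that]] by simp
    qed
  qed (use q r Suc.prems in \<open>simp_all add: solves_forward_system_def\<close>)
  then show ?case by simp
qed

theorem proposition1p1:
  "solves_forward_system p \<and>
   (\<forall>q. solves_forward_system q \<longrightarrow> (\<forall>k. \<forall>t\<ge>0. q k t = p k t))"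
  using p_solves forward_system_unique by blast

end
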